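(* Let $(J,R,Q,B)\in\Sigma_{n,m}$ and $S\in\mathbb{K}^{m\times m}$ with $S^H=S\ge 0$. Then the following statements are equivalent: (i) The pencil $s\mathcal{E}-\mathcal{A}_S$ is regular. (ii) There exists $\mu\in\mathbb{K}\setminus\big(\sigma(-((J-R)Q)^H)\cup\sigma((J-R)Q)\big)$ such that the matrix $$S_\mu := S-\begin{bmatrix}B^H & 0\end{bmatrix}\begin{bmatrix}0 & (J-R)Q-\mu I\\ ((J-R)Q)^H+\mu I & QRQ\end{bmatrix}^{-1}\begin{bmatrix}B\\0\end{bmatrix}\in\mathbb{K}^{m\times m}$$ is invertible. (iii) There exists $\omega\in\mathbb{R}$ such that $i\omega\notin\sigma((J-R)Q)$ and $\ker S\cap\ker RQ\big((J-R)Q-i\omega I\big)^{-1}B=\{0\}$. (iv) There exists $\omega\in\mathbb{R}$ such that $i\omega\notin\sigma(JQ)$ and $\ker S\cap\ker RQ\big(JQ-i\omega I\big)^{-1}B=\{0\}$. (v) There exists $\omega\in\mathbb{R}$ such that $i\omega\notin\sigma(JQ)$ and $\ker S\cap B^{-1}(JQ-i\omega I)\ker RQ=\{0\}$.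
   Context: $\mathbb{K}\in\{\mathbb{R},\mathbb{C}\}$, $n,m$ are positive integers, $A^H$ is the conjugate transpose, $\sigma(A)$ is the set of (complex) eigenvalues of a square matrix $A$, and $A\ge0$ means $x^HAx\ge0$ for all $x$. $\Sigma_{n,m}$ is the set of all $(J,R,Q,B)\in(\mathbb{K}^{n\times n})^3\times\mathbb{K}^{n\times m}$ with $J=-J^H$, $R=R^H\ge0$, $Q=Q^H\ge0$. The optimality pencil $s\mathcal{E}-\mathcal{A}_S$ has coefficients $$\mathcal{E}=\begin{bmatrix}0_{n\times n}&I_n&0_{n\times m}\\-I_n&0_{n\times n}&0_{n\times m}\\0_{m\times n}&0_{m\times n}&0_{m\times m}\end{bmatrix},\qquad \mathcal{A}_S=\begin{bmatrix}0_{n\times n}&(J-R)Q&B\\((J-R)Q)^H&QRQ&0_{n\times m}\\ B^H&0_{m\times n}&S\end{bmatrix}.$$ It is called regular if $\det(s\mathcal{E}-\mathcal{A}_S)$ is not the zero polynomial in $s$. $B^{-1}W$ denotes the preimage $\{u: Bu\in W\}$ of a subspace $W$ under $B$, and $(JQ-i\omega I)\ker RQ$ is the image of $\ker RQ$ under $JQ-i\omega I$. If $\mathbb{K}=\mathbb{R}$, kernels, images and preimages in expressions involving $i\omega$ are taken over $\mathbb{C}$. *)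

theory Defs
  imports "HOL-Analysis.Analysis" "HOL-Computational_Algebra.Polynomial"
begin

text \<open>
  The ground field is given as a subset \<open>K\<close> of the complex numbers, either
  \<open>\<real>\<close> or \<open>UNIV\<close>. A matrix over \<open>K\<close> is a complex matrix with entries in \<open>K\<close>,
  so that spectra, kernels, images and preimages are always taken over the complex
  numbers, also for \<open>K = \<real>\<close>.
\<close>

definition mats :: "complex set \<Rightarrow> (complex^'c^'r) set" where
  "mats K = {A. \<forall>i j. A $ i $ j \<in> K}"

definition vecs :: "complex set \<Rightarrow> (complex^'n) set" where
  "vecs K = {x. \<forall>i. x $ i \<in> K}"

definition adj :: "complex^'c^'r \<Rightarrow> complex^'r^'c" where
  "adj A = (\<chi> i j. cnj (A $ j $ i))"

text \<open>\<open>x\<^sup>H A x \<ge> 0\<close>, which includes that the value is real, for all \<open>x\<close> over \<open>K\<close>.\<close>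

definition psd :: "complex set \<Rightarrow> complex^'n^'n \<Rightarrow> bool" where
  "psd K A \<longleftrightarrow> (\<forall>x\<in>vecs K. (\<Sum>i\<in>UNIV. cnj (x $ i) * (A *v x) $ i) \<in> \<real>\<^sub>\<ge>\<^sub>0)"

definition spectrum :: "complex^'n^'n \<Rightarrow> complex set" where
  "spectrum A = {z. \<exists>x. x \<noteq> 0 \<and> A *v x = z *s x}"

definition ker :: "complex^'c^'r \<Rightarrow> (complex^'c) set" where
  "ker A = {x. A *v x = 0}"

definition hcat :: "'a^'p^'r \<Rightarrow> 'a^'q^'r \<Rightarrow> 'a^('p::finite + 'q::finite)^'r" where
  "hcat A B = (\<chi> i j. case j of Inl k \<Rightarrow> A $ i $ k | Inr k \<Rightarrow> B $ i $ k)"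

definition vcat :: "'a^'c^'p \<Rightarrow> 'a^'c^'q \<Rightarrow> 'a^'c^('p::finite + 'q::finite)" where
  "vcat A B = (\<chi> i. case i of Inl k \<Rightarrow> A $ k | Inr k \<Rightarrow> B $ k)"

definition block :: "'a^'p^'r \<Rightarrow> 'a^'q^'r \<Rightarrow> 'a^'p^'s \<Rightarrow> 'a^'q^'s \<Rightarrow> 'a^('p::finite + 'q::finite)^('r::finite + 's::finite)" where
  "block A B C D = vcat (hcat A B) (hcat C D)"

definition Sigma_ph ::
  "complex set \<Rightarrow>
    ((complex^'n^'n) \<times> (complex^'n^'n) \<times> (complex^'n^'n) \<times> (complex^'m^'n)) set" where
  "Sigma_ph K = {(J, R, Q, B).
     J \<in> mats K \<and> R \<in> mats K \<and> Q \<in> mats K \<and> B \<in> mats K \<and>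
     J = - adj J \<and> R = adj R \<and> psd K R \<and> Q = adj Q \<and> psd K Q}"

text \<open>The \<open>3 \<times> 3\<close> block matrices are partitioned with the leading \<open>2 \<times> 2\<close> part as one block.\<close>

definition E_mat :: "complex^(('n::finite + 'n) + 'm::finite)^(('n + 'n) + 'm)" where
  "E_mat = block (block 0 (mat 1) (- mat 1) 0) 0 0 0"

definition A_mat ::
  "complex^'n^'n \<Rightarrow> complex^'n^'n \<Rightarrow> complex^'n^'n \<Rightarrow> complex^'m^'n \<Rightarrow> complex^'m^'m
    \<Rightarrow> complex^(('n::finite + 'n) + 'm::finite)^(('n + 'n) + 'm)" where
  "A_mat J R Q B S =
     block (block 0 ((J - R) ** Q) (adj ((J - R) ** Q)) (Q ** R ** Q)) (vcat B 0)
           (hcat (adj B) 0) S"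

text \<open>\<open>s E - A\<close> is formed as a matrix of polynomials in \<open>s\<close>; the entry \<open>[:- a, e:]\<close> is \<open>s e - a\<close>.\<close>

definition regular_pencil :: "complex^'n^'n \<Rightarrow> complex^'n^'n \<Rightarrow> bool" where
  "regular_pencil E A \<longleftrightarrow> det (\<chi> i j. [:- (A $ i $ j), E $ i $ j:]) \<noteq> 0"

text \<open>
  The block matrix inverted here is invertible whenever \<open>\<mu>\<close> lies in neither of the spectra of
  \<open>(J - R) Q\<close> and \<open>- ((J - R) Q)\<^sup>H\<close>; \<^const>\<open>matrix_inv\<close> is unspecified otherwise.
\<close>

definition S_mu ::
  "complex^'n^'n \<Rightarrow> complex^'n^'n \<Rightarrow> complex^'n^'n \<Rightarrow> complex^'m^'n \<Rightarrow> complex^'m^'m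
    \<Rightarrow> complex \<Rightarrow> complex^'m^'m" where
  "S_mu J R Q B S \<mu> =
     S - hcat (adj B) (0 :: complex^'n^'m)
         ** matrix_inv (block 0 ((J - R) ** Q - mat \<mu>) (adj ((J - R) ** Q) + mat \<mu>) (Q ** R ** Q))
         ** vcat B (0 :: complex^'m^'n)"

end

theory Submission
  imports Defs
begin

text \<open>
  Write \<open>A = (J - R) Q\<close>. A pencil is regular as soon as one value \<open>s\<close> of the parameter gives a
  matrix with trivial kernel, and then all but finitely many values do, because the determinant is
  a polynomial (\<open>regular_pencilI\<close>, \<open>finite_pencil_eigenvalues\<close>). Spectra are finite too. So each
  of the other conditions only has to be compared with the triviality of the kernel of
  \<open>s \<E> - \<A>\<^sub>S\<close> at a single admissible parameter \<open>s\<close>.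

  For \<open>s = \<mu>\<close> as in (ii) the leading block of \<open>\<A>\<^sub>S - \<mu> \<E>\<close> is invertible and \<open>S\<^sub>\<mu>\<close> is its Schur
  complement, which settles (ii) (\<open>A_mat_kernel_iff_S_mu\<close>).

  For \<open>s = i \<omega>\<close> dissipativity enters. If \<open>(x, y, u)\<close> is in the kernel, pairing the three block rows
  with each other gives \<open>u\<^sup>H S u = - y\<^sup>H Q R Q y\<close>. Both forms are nonnegative, so \<open>S u = 0\<close> and
  \<open>R Q y = 0\<close> (\<open>A_mat_kernel_imaginary\<close>), and then \<open>x\<close> solves the homogeneous equation
  \<open>(A - i \<omega>)\<^sup>H x = 0\<close>. If \<open>i \<omega>\<close> is not an eigenvalue of \<open>A\<close>, then \<open>x = 0\<close> and
  \<open>y = - (A - i \<omega>)\<^sup>-\<^sup>1 B u\<close>, and what remains is the condition on \<open>u\<close> in (iii).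

  On \<open>ker (R Q)\<close> the matrices \<open>A\<close> and \<open>J Q\<close> agree. This makes (iii), (iv) and (v) the same condition
  on \<open>u\<close>, for every \<open>\<omega>\<close> that is admissible in both (iii) and (iv). Moreover the eigenvectors of \<open>A\<close>
  for an imaginary eigenvalue lie in \<open>ker (R Q)\<close>, so that this eigenvalue is one of \<open>J Q\<close> as well
  (\<open>imaginary_spectrum_subset\<close>) and an \<open>\<omega>\<close> that is admissible in (iv) is admissible in (iii).
  The passage from (iii) to (iv) may have to change \<open>\<omega>\<close> and goes through regularity.

  Over the real field, semidefiniteness carries over to complex vectors by splitting these into real
  and imaginary parts, and inverses of real matrices are real.
\<close>

section \<open>Hermitian form and semidefiniteness\<close>

definition cinner :: "complex^'n \<Rightarrow> complex^'n \<Rightarrow> complex" where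
  "cinner x y = (\<Sum>i\<in>UNIV. cnj (x $ i) * y $ i)"

lemma cinner_add_left: "cinner (x + y) z = cinner x z + cinner y z"
  and cinner_add_right: "cinner x (y + z) = cinner x y + cinner x z"
  and cinner_scale_left: "cinner (c *s x) y = cnj c * cinner x y"
  and cinner_scale_right: "cinner x (c *s y) = c * cinner x y"
  and cinner_minus_left: "cinner (- x) y = - cinner x y"
  and cinner_minus_right: "cinner x (- y) = - cinner x y"
  and cinner_zero_left: "cinner 0 x = 0"
  by (simp_all add: cinner_def algebra_simps sum.distrib sum_distrib_left sum_negf)

lemma cinner_diff_left: "cinner (x - y) z = cinner x z - cinner y z"
  and cinner_diff_right: "cinner x (y - z) = cinner x y - cinner x z"
  by (simp_all add: cinner_def algebra_simps sum_subtractf)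

lemmas cinner_simps = cinner_add_left cinner_add_right cinner_scale_left cinner_scale_right
  cinner_minus_left cinner_minus_right cinner_diff_left cinner_diff_right

lemma cnj_cinner: "cnj (cinner x y) = cinner y x"
  by (simp add: cinner_def mult.commute)

lemma cinner_adj: "cinner (adj A *v x) y = cinner x (A *v y)"
proof -
  have "cinner (adj A *v x) y = (\<Sum>j\<in>UNIV. \<Sum>i\<in>UNIV. cnj (x $ i) * (A $ i $ j * y $ j))"
    by (simp add: cinner_def adj_def matrix_vector_mult_def sum_distrib_right sum_distrib_left ac_simps)
  also have "\<dots> = (\<Sum>i\<in>UNIV. \<Sum>j\<in>UNIV. cnj (x $ i) * (A $ i $ j * y $ j))"
    by (rule sum.swap)
  also have "\<dots> = cinner x (A *v y)"
    by (simp add: cinner_def matrix_vector_mult_def sum_distrib_left)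
  finally show ?thesis .
qed

lemma cinner_adj_right: "cinner x (adj A *v y) = cinner (A *v x) y"
  by (metis cinner_adj cnj_cinner)

lemma cinner_self: "cinner x x = of_real (\<Sum>i\<in>UNIV. (cmod (x $ i))\<^sup>2)"
  unfolding cinner_def of_real_sum complex_norm_square by (simp add: mult.commute)

lemma cinner_self_pos: "x \<noteq> 0 \<Longrightarrow> \<exists>a>0. cinner x x = of_real a"
proof -
  assume "x \<noteq> 0"
  then obtain i where "x $ i \<noteq> 0" by (auto simp: vec_eq_iff)
  then have "(\<Sum>i\<in>UNIV. (cmod (x $ i))\<^sup>2) > 0"
    by (intro sum_pos2[of _ i]) auto
  then show ?thesis using cinner_self by blast
qed

lemma psd_iff: "psd K A \<longleftrightarrow> (\<forall>x\<in>vecs K. cinner x (A *v x) \<in> \<real>\<^sub>\<ge>\<^sub>0)"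
  by (simp add: psd_def cinner_def)

lemma nonneg_Reals_add_eq_0:
  assumes "a \<in> \<real>\<^sub>\<ge>\<^sub>0" "b \<in> \<real>\<^sub>\<ge>\<^sub>0" "a + b = (0::complex)"
  shows "a = 0" "b = 0"
  using assms by (auto simp: complex_nonneg_Reals_iff complex_eq_iff)

text \<open>
  For a real symmetric matrix the cross terms between real and imaginary part of \<open>x\<close> cancel in
  \<open>x\<^sup>H A x\<close>.
\<close>

lemma psd_UNIV_if_psd:
  fixes A :: "complex^'n^'n"
  assumes K: "K = \<real> \<or> K = UNIV" and A: "A \<in> mats K" "adj A = A" "psd K A"
  shows "psd UNIV A"
proof (cases "K = UNIV")
  case True
  then show ?thesis using A by simp
next
  case False
  with K have K: "K = \<real>" by simp
  show ?thesis unfolding psd_iff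
  proof
    fix x :: "complex^'n"
    define a b :: "complex^'n" where "a = (\<chi> i. of_real (Re (x $ i)))" and "b = (\<chi> i. of_real (Im (x $ i)))"
    have x: "x = a + \<i> *s b"
      by (simp add: a_def b_def vec_eq_iff complex_eq)
    have ab: "a \<in> vecs \<real>" "b \<in> vecs \<real>" by (auto simp: a_def b_def vecs_def)
    have "cinner a (A *v b) \<in> \<real>"
      unfolding cinner_def matrix_vector_mult_def using ab A(1) K
      by (auto simp: vecs_def mats_def Reals_cnj_iff intro!: sum_in_Reals Reals_mult)
    then have "cinner b (A *v a) = cinner a (A *v b)"
      by (metis A(2) Reals_cnj_iff cinner_adj cnj_cinner)
    then have "cinner x (A *v x) = cinner a (A *v a) + cinner b (A *v b)"
      unfolding x by (simp add: cinner_simps matrix_vector_right_distrib vector_scalar_commute algebra_simps)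
    then show "cinner x (A *v x) \<in> \<real>\<^sub>\<ge>\<^sub>0"
      using A(3) ab K by (simp add: psd_iff)
  qed
qed

text \<open>
  Moving from \<open>x\<close> in the direction \<open>- A x\<close> would make the form negative to first order if \<open>A x\<close>
  did not vanish.
\<close>

lemma psd_form_eq_0:
  assumes A: "adj A = A" "psd UNIV A" and 0: "cinner x (A *v x) = 0"
  shows "A *v x = 0"
proof (rule ccontr)
  define y where "y = A *v x"
  assume "A *v x \<noteq> 0"
  then obtain a where a: "a > 0" "cinner y y = of_real a"
    using cinner_self_pos y_def by blast
  obtain c where c: "c \<ge> 0" "cinner y (A *v y) = of_real c"
    using A(2) by (auto simp: psd_iff vecs_def nonneg_Reals_def)
  have xy: "cinner x (A *v y) = of_real a"
    using a A(1) by (metis cinner_adj y_def)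
  \<comment> \<open>A step so short that the second-order term \<open>t\<^sup>2 c\<close> cannot outweigh the first-order gain \<open>2 t a\<close>.\<close>
  define t where "t = a / (c + 1)"
  have t: "t > 0" using a c by (simp add: t_def)
  define z where "z = x - of_real t *s y"
  have "cinner z (A *v z) = of_real (t * (t * c - 2 * a))"
    using 0 a c xy unfolding z_def
    by (simp add: cinner_simps matrix_vector_mult_diff_distrib vector_scalar_commute
        y_def[symmetric] algebra_simps)
  moreover have "cinner z (A *v z) \<in> \<real>\<^sub>\<ge>\<^sub>0" using A(2) by (simp add: psd_iff vecs_def)
  ultimately have "t * (t * c - 2 * a) \<ge> 0" by (metis complex_nonneg_Reals_iff Re_complex_of_real)
  then have "t * c \<ge> 2 * a" using t by (simp add: zero_le_mult_iff)
  moreover have "t * c \<le> a" using a c by (simp add: t_def field_simps)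
  ultimately show False using a by simp
qed

section \<open>Block vectors\<close>

definition vjoin :: "'a^'p \<Rightarrow> 'a^'q \<Rightarrow> 'a^('p::finite + 'q::finite)" where
  "vjoin x y = (\<chi> i. case i of Inl k \<Rightarrow> x $ k | Inr k \<Rightarrow> y $ k)"

lemma vjoin_cases: obtains x y where "z = vjoin x y"
proof
  show "z = vjoin (\<chi> k. z $ Inl k) (\<chi> k. z $ Inr k)"
    by (simp add: vjoin_def vec_eq_iff split: sum.split)
qed

lemma ex_vjoin: "(\<exists>z. P z) \<longleftrightarrow> (\<exists>x y. P (vjoin x y))"
  by (metis vjoin_cases)

lemma vjoin_eq_iff: "vjoin x y = vjoin x' y' \<longleftrightarrow> x = x' \<and> y = y'"
  by (auto simp: vjoin_def vec_eq_iff split: sum.splits)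

lemma zero_eq_vjoin: "0 = vjoin 0 0"
  and vjoin_eq_0_iff: "vjoin v w = 0 \<longleftrightarrow> v = 0 \<and> w = 0"
  and vjoin_add: "vjoin x y + vjoin x' y' = vjoin (x + x') (y + y')"
  and vjoin_scale: "c *s vjoin v w = vjoin (c *s v) (c *s w)"
  by (auto simp: vjoin_def vec_eq_iff split: sum.splits)

lemma hcat_mult_vjoin: "hcat A B *v vjoin x y = A *v x + B *v y"
proof -
  have "(\<Sum>j\<in>UNIV. hcat A B $ i $ j * vjoin x y $ j) =
      (\<Sum>k\<in>UNIV. A $ i $ k * x $ k) + (\<Sum>k\<in>UNIV. B $ i $ k * y $ k)" for i
    by (subst UNIV_Plus_UNIV[symmetric], subst sum.Plus) (simp_all add: hcat_def vjoin_def)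
  then show ?thesis by (simp add: vec_eq_iff matrix_vector_mult_def)
qed

lemma vcat_mult: "vcat A B *v x = vjoin (A *v x) (B *v x)"
  by (simp add: vec_eq_iff vcat_def vjoin_def matrix_vector_mult_def split: sum.split)

lemma block_mult_vjoin:
  "block A B C D *v vjoin x y = vjoin (A *v x + B *v y) (C *v x + D *v y)"
  by (simp add: block_def vcat_mult hcat_mult_vjoin)

section \<open>Inverses\<close>

lemma invertible_iff_kernel:
  fixes A :: "'a::field^'n^'n"
  shows "invertible A \<longleftrightarrow> (\<forall>x. A *v x = 0 \<longrightarrow> x = 0)"
  by (simp add: invertible_left_inverse matrix_left_invertible_ker)

lemma matrix_inv_both:
  assumes "invertible A"
  shows "A ** matrix_inv A = mat 1" "matrix_inv A ** A = mat 1"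
  using someI_ex[OF assms[unfolded invertible_def]] by (simp_all add: matrix_inv_def)

lemma mult_eq_iff_matrix_inv:
  assumes "invertible A"
  shows "A *v y = b \<longleftrightarrow> y = matrix_inv A *v b"
  by (metis assms matrix_inv_both matrix_vector_mul_assoc matrix_vector_mul_lid)

lemma mat_mult_vector: "mat z *v x = z *s x"
  by (simp add: vec_eq_iff matrix_vector_mult_def mat_def if_distrib[of "\<lambda>a. a * _"] cong: if_cong)

lemma minus_matrix_vector_mult: "(- A) *v x = - (A *v x)" for A :: "'a::ring_1^'c^'r"
  by (simp add: vec_eq_iff matrix_vector_mult_def sum_negf)

lemma invertible_diff_mat_iff: "invertible (A - mat z) \<longleftrightarrow> z \<notin> spectrum A"
  by (auto simp: invertible_iff_kernel spectrum_def matrix_vector_mult_diff_rdistrib mat_mult_vector)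

section \<open>Regular pencils\<close>

lemma poly_det: "poly (det P) s = det (\<chi> i j. poly (P $ i $ j) s)"
  by (simp add: det_def poly_sum poly_prod)

lemma poly_det_pencil_eq_0_iff:
  fixes E A :: "complex^'n^'n"
  shows "poly (det (\<chi> i j. [:- (A $ i $ j), E $ i $ j:])) s = 0 \<longleftrightarrow>
    (\<exists>z. z \<noteq> 0 \<and> A *v z = s *s (E *v z))"
proof -
  define M where "M = (\<chi> i j. s * E $ i $ j - A $ i $ j)"
  have M: "M *v z = s *s (E *v z) - A *v z" for z
    by (simp add: M_def vec_eq_iff matrix_vector_mult_def algebra_simps sum_subtractf sum_distrib_left)
  have "poly (det (\<chi> i j. [:- (A $ i $ j), E $ i $ j:])) s = det M"
    unfolding poly_det by (rule arg_cong[where f = det]) (simp add: M_def vec_eq_iff)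
  then show ?thesis
    using invertible_det_nz[of M] by (auto simp: invertible_iff_kernel M)
qed

lemma regular_pencilI:
  assumes "\<And>z. A *v z = s *s (E *v z) \<Longrightarrow> z = 0"
  shows "regular_pencil E A"
  using assms poly_det_pencil_eq_0_iff[of A E s] unfolding regular_pencil_def by force

lemma finite_pencil_eigenvalues:
  assumes "regular_pencil E A"
  shows "finite {s. \<exists>z. z \<noteq> 0 \<and> A *v z = s *s (E *v z)}"
  using poly_roots_finite[OF assms[unfolded regular_pencil_def]]
  by (simp add: poly_det_pencil_eq_0_iff)

text \<open>
  The reversed pencil \<open>s A - I\<close> is visibly regular, since at \<open>s = 0\<close> it equals \<open>- I\<close>, and its
  eigenvalues are the reciprocals of the nonzero eigenvalues of \<open>A\<close>.
\<close>

lemma finite_spectrum: "finite (spectrum A)"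
proof -
  let ?T = "{s. \<exists>z. z \<noteq> 0 \<and> mat 1 *v z = s *s (A *v z)}"
  have "regular_pencil A (mat 1)"
    by (rule regular_pencilI[where s = 0]) simp
  then have "finite ?T" by (rule finite_pencil_eigenvalues)
  moreover have "spectrum A \<subseteq> insert 0 (inverse ` ?T)"
  proof
    fix s assume "s \<in> spectrum A"
    then obtain z where z: "z \<noteq> 0" "A *v z = s *s z" by (auto simp: spectrum_def)
    show "s \<in> insert 0 (inverse ` ?T)"
    proof (cases "s = 0")
      case False
      then have "mat 1 *v z = inverse s *s (A *v z)" by (simp add: z)
      then have "inverse s \<in> ?T" using z(1) by blast
      from imageI[OF this, of inverse] show ?thesis by simp
    qed simp
  qed
  ultimately show ?thesis by (meson finite_imageI finite_insert finite_subset)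
qed

lemma ex_imaginary_notin_finite:
  assumes "finite F"
  shows "\<exists>\<omega>::real. \<i> * of_real \<omega> \<notin> F"
proof -
  have "finite ((\<lambda>\<omega>::real. \<i> * of_real \<omega>) -` F)"
    using assms by (rule finite_vimageI) (simp add: inj_def)
  then show ?thesis
    using ex_new_if_finite[OF infinite_UNIV_char_0] by fastforce
qed

section \<open>Matrices over the ground field\<close>

lemma mats_Reals_iff: "A \<in> mats \<real> \<longleftrightarrow> map_matrix cnj A = A"
  by (simp add: mats_def map_matrix_def vec_eq_iff Reals_cnj_iff)

text \<open>The entrywise conjugate of an inverse of a real matrix is again an inverse of it.\<close>

lemma matrix_inv_in_mats_Reals:
  fixes A :: "complex^'n^'n"
  assumes "A \<in> mats \<real>" "invertible A"
  shows "matrix_inv A \<in> mats \<real>"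
proof -
  let ?c = "\<lambda>M :: complex^'n^'n. map_matrix cnj M"
  have "?c (matrix_inv A) ** A = ?c (matrix_inv A ** A)"
    using assms(1)
    by (simp add: mats_def Reals_cnj_iff map_matrix_def matrix_matrix_mult_def vec_eq_iff)
  also have "\<dots> = mat 1"
    using matrix_inv_both[OF assms(2)] by (simp add: map_matrix_def mat_def vec_eq_iff)
  finally have "?c (matrix_inv A) = matrix_inv A"
    by (metis assms(2) matrix_inv_both(1) matrix_mul_assoc matrix_mul_lid matrix_mul_rid)
  then show ?thesis by (simp add: mats_Reals_iff)
qed

lemma mats_Reals_add: "A \<in> mats \<real> \<Longrightarrow> B \<in> mats \<real> \<Longrightarrow> A + B \<in> mats \<real>"
  and mats_Reals_diff: "A \<in> mats \<real> \<Longrightarrow> B \<in> mats \<real> \<Longrightarrow> A - B \<in> mats \<real>"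
  and mats_Reals_mat: "\<mu> \<in> \<real> \<Longrightarrow> mat \<mu> \<in> mats \<real>"
  and mats_Reals_zero: "0 \<in> mats \<real>"
  by (simp_all add: mats_def mat_def)

lemma mats_Reals_adj: "A \<in> mats \<real> \<Longrightarrow> adj A \<in> mats \<real>"
  unfolding mats_def adj_def Reals_cnj_iff by simp

lemma mats_Reals_mult: "A \<in> mats \<real> \<Longrightarrow> B \<in> mats \<real> \<Longrightarrow> A ** B \<in> mats \<real>"
  unfolding mats_def matrix_matrix_mult_def by (simp add: sum_in_Reals)

lemma mats_Reals_hcat: "A \<in> mats \<real> \<Longrightarrow> B \<in> mats \<real> \<Longrightarrow> hcat A B \<in> mats \<real>"
  and mats_Reals_vcat: "C \<in> mats \<real> \<Longrightarrow> D \<in> mats \<real> \<Longrightarrow> vcat C D \<in> mats \<real>"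
  unfolding mats_def hcat_def vcat_def by (simp_all split: sum.split)

lemmas mats_Reals_closed = mats_Reals_add mats_Reals_diff mats_Reals_mat mats_Reals_zero
  mats_Reals_adj mats_Reals_mult mats_Reals_hcat mats_Reals_vcat

section \<open>The optimality pencil and its Schur complement\<close>

text \<open>
  The pair \<open>(w, u)\<close> is a kernel vector of \<open>[N b; c S]\<close>; its first component is determined by \<open>u\<close>.
\<close>

lemma schur_complement_kernel:
  fixes N :: "complex^'n^'n" and S :: "complex^'m^'m"
  assumes "invertible N"
  shows "(\<exists>w u. (w \<noteq> 0 \<or> u \<noteq> 0) \<and> N *v w + b *v u = 0 \<and> c *v w + S *v u = 0) \<longleftrightarrow>
    \<not> invertible (S - c ** matrix_inv N ** b)"
proof -
  define f where "f u = - (matrix_inv N *v (b *v u))" for u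
  have f0: "f 0 = 0" by (simp add: f_def)
  have *: "N *v w + b *v u = 0 \<longleftrightarrow> w = f u" for w u
  proof -
    have "N *v w + b *v u = 0 \<longleftrightarrow> N *v w = - (b *v u)" by (simp add: eq_neg_iff_add_eq_0)
    also have "\<dots> \<longleftrightarrow> w = matrix_inv N *v (- (b *v u))" by (rule mult_eq_iff_matrix_inv[OF assms])
    finally show ?thesis by (simp add: f_def vec.neg)
  qed
  have "(\<exists>w u. (w \<noteq> 0 \<or> u \<noteq> 0) \<and> N *v w + b *v u = 0 \<and> c *v w + S *v u = 0) \<longleftrightarrow>
      (\<exists>u. u \<noteq> 0 \<and> c *v f u + S *v u = 0)"
    by (metis * f0)
  also have "\<dots> \<longleftrightarrow> (\<exists>u. u \<noteq> 0 \<and> (S - c ** matrix_inv N ** b) *v u = 0)"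
    by (simp add: f_def vec.neg matrix_vector_mult_diff_rdistrib matrix_vector_mul_assoc matrix_mul_assoc)
  finally show ?thesis by (auto simp: invertible_iff_kernel)
qed

lemma A_mat_eigen_iff:
  "A_mat J R Q B S *v vjoin (vjoin x y) u = s *s (E_mat *v vjoin (vjoin x y) u) \<longleftrightarrow>
    ((J - R) ** Q) *v y + B *v u = s *s y \<and>
    adj ((J - R) ** Q) *v x + (Q ** R ** Q) *v y = - (s *s x) \<and>
    adj B *v x + S *v u = 0"
proof -
  have "E_mat *v vjoin (vjoin x y) u = vjoin (vjoin y (- x)) 0"
    by (simp add: E_mat_def block_mult_vjoin zero_eq_vjoin[symmetric] minus_matrix_vector_mult)
  then show ?thesis
    by (simp add: A_mat_def block_mult_vjoin vcat_mult hcat_mult_vjoin vjoin_add vjoin_scale vjoin_eq_iff)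
qed

definition leading_block ::
  "complex^'n^'n \<Rightarrow> complex^'n^'n \<Rightarrow> complex^'n^'n \<Rightarrow> complex \<Rightarrow> complex^('n + 'n)^('n + 'n)" where
  "leading_block J R Q \<mu> =
    block 0 ((J - R) ** Q - mat \<mu>) (adj ((J - R) ** Q) + mat \<mu>) (Q ** R ** Q)"

lemma invertible_leading_block:
  assumes "\<mu> \<notin> spectrum (- adj ((J - R) ** Q)) \<union> spectrum ((J - R) ** Q)"
  shows "invertible (leading_block J R Q \<mu>)"
  unfolding invertible_iff_kernel
proof (intro allI impI)
  fix z assume z: "leading_block J R Q \<mu> *v z = 0"
  obtain x y where xy: "z = vjoin x y" by (rule vjoin_cases)
  have 1: "((J - R) ** Q - mat \<mu>) *v y = 0" and
    2: "(adj ((J - R) ** Q) + mat \<mu>) *v x + (Q ** R ** Q) *v y = 0"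
    using z by (simp_all add: xy leading_block_def block_mult_vjoin zero_eq_vjoin vjoin_eq_iff)
  have "invertible ((J - R) ** Q - mat \<mu>)" using assms by (simp add: invertible_diff_mat_iff)
  with 1 have y: "y = 0" by (simp add: invertible_iff_kernel)
  with 2 have "(- adj ((J - R) ** Q)) *v x = \<mu> *s x"
    by (simp add: matrix_vector_mult_add_rdistrib mat_mult_vector minus_matrix_vector_mult
        minus_unique)
  then have "x = 0" using assms by (auto simp: spectrum_def)
  with y show "z = 0" by (simp add: xy zero_eq_vjoin)
qed

lemma A_mat_kernel_iff_S_mu:
  assumes "\<mu> \<notin> spectrum (- adj ((J - R) ** Q)) \<union> spectrum ((J - R) ** Q)"
  shows "(\<exists>z. z \<noteq> 0 \<and> A_mat J R Q B S *v z = \<mu> *s (E_mat *v z)) \<longleftrightarrow>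
    \<not> invertible (S_mu J R Q B S \<mu>)"
proof -
  have *: "A_mat J R Q B S *v vjoin w u = \<mu> *s (E_mat *v vjoin w u) \<longleftrightarrow>
      leading_block J R Q \<mu> *v w + vcat B 0 *v u = 0 \<and> hcat (adj B) 0 *v w + S *v u = 0" for w u
  proof -
    obtain x y where w: "w = vjoin x y" by (rule vjoin_cases)
    have row1: "p + b = \<mu> *s y \<longleftrightarrow> (p - \<mu> *s y) + b = 0" for p b
      by (auto simp: algebra_simps)
    have row2: "p + q = - (\<mu> *s x) \<longleftrightarrow> (p + \<mu> *s x) + q = 0" for p q
      by (simp add: eq_neg_iff_add_eq_0 ac_simps)
    show ?thesis unfolding w A_mat_eigen_iff row1 row2
      by (simp add: leading_block_def block_mult_vjoin vcat_mult hcat_mult_vjoin vjoin_add vjoin_eq_iff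
        zero_eq_vjoin matrix_vector_mult_add_rdistrib matrix_vector_mult_diff_rdistrib mat_mult_vector)
  qed
  have "(\<exists>z. z \<noteq> 0 \<and> A_mat J R Q B S *v z = \<mu> *s (E_mat *v z)) \<longleftrightarrow>
      (\<exists>w u. (w \<noteq> 0 \<or> u \<noteq> 0) \<and> leading_block J R Q \<mu> *v w + vcat B 0 *v u = 0 \<and>
        hcat (adj B) 0 *v w + S *v u = 0)"
    by (subst ex_vjoin) (simp only: * vjoin_eq_0_iff de_Morgan_conj)
  also have "\<dots> \<longleftrightarrow> \<not> invertible (S_mu J R Q B S \<mu>)"
    unfolding S_mu_def leading_block_def[symmetric]
    by (rule schur_complement_kernel[OF invertible_leading_block[OF assms]])
  finally show ?thesis .
qed

lemma S_mu_in_mats: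
  assumes "K = \<real> \<or> K = UNIV" "J \<in> mats K" "R \<in> mats K" "Q \<in> mats K" "B \<in> mats K" "S \<in> mats K"
    "\<mu> \<in> K" "\<mu> \<notin> spectrum (- adj ((J - R) ** Q)) \<union> spectrum ((J - R) ** Q)"
  shows "S_mu J R Q B S \<mu> \<in> mats K"
proof (cases "K = UNIV")
  case True
  then show ?thesis by (simp add: mats_def)
next
  case False
  with assms(1) have K: "K = \<real>" by simp
  have "leading_block J R Q \<mu> \<in> mats \<real>"
    using assms(2-7) unfolding K leading_block_def block_def by (intro mats_Reals_closed)
  then have "matrix_inv (leading_block J R Q \<mu>) \<in> mats \<real>"
    by (rule matrix_inv_in_mats_Reals[OF _ invertible_leading_block[OF assms(8)]])
  then show ?thesis
    using assms(2-7) unfolding K S_mu_def leading_block_def[symmetric] by (intro mats_Reals_closed)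
qed

section \<open>The imaginary axis\<close>

lemma QRQ_form:
  assumes "adj Q = Q"
  shows "cinner y ((Q ** R ** Q) *v y) = cinner (Q *v y) (R *v (Q *v y))"
  by (metis assms cinner_adj matrix_mul_assoc matrix_vector_mul_assoc)

lemma QRQ_form_nonneg:
  assumes "adj Q = Q" "psd UNIV R"
  shows "cinner y ((Q ** R ** Q) *v y) \<in> \<real>\<^sub>\<ge>\<^sub>0"
  using assms by (simp add: QRQ_form psd_iff vecs_def)

lemma QRQ_form_eq_0:
  assumes "adj Q = Q" "adj R = R" "psd UNIV R" "cinner y ((Q ** R ** Q) *v y) = 0"
  shows "(R ** Q) *v y = 0"
  using psd_form_eq_0[OF assms(2,3), of "Q *v y"] assms(4)
  by (simp add: QRQ_form[OF assms(1)] matrix_vector_mul_assoc)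

text \<open>
  With \<open>D = A - i \<omega>\<close> the three rows read \<open>D y = - B u\<close>, \<open>D\<^sup>H x = - Q R Q y\<close> and \<open>B\<^sup>H x = - S u\<close>.
  Hence \<open>u\<^sup>H S u = - (B u)\<^sup>H x = y\<^sup>H D\<^sup>H x = - y\<^sup>H Q R Q y\<close>. That \<open>i \<omega>\<close> is imaginary is what makes the
  second row involve the adjoint of \<open>D\<close>.
\<close>

lemma A_mat_kernel_imaginary:
  assumes psd: "adj Q = Q" "adj R = R" "psd UNIV R" "adj S = S" "psd UNIV S"
    and rows: "((J - R) ** Q) *v y + B *v u = (\<i> * of_real \<omega>) *s y"
    "adj ((J - R) ** Q) *v x + (Q ** R ** Q) *v y = - ((\<i> * of_real \<omega>) *s x)"
    "adj B *v x + S *v u = 0"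
  shows "S *v u = 0" "(R ** Q) *v y = 0"
proof -
  let ?A = "(J - R) ** Q" and ?s = "\<i> * of_real \<omega> :: complex"
  have S: "S *v u = - (adj B *v x)" using rows(3) by (simp add: add_eq_0_iff)
  have B: "B *v u = ?s *s y - ?A *v y" using rows(1) by (simp add: algebra_simps)
  have A: "(Q ** R ** Q) *v y = - (?s *s x) - adj ?A *v x" using rows(2) by (simp add: algebra_simps)
  have "cinner u (S *v u) = - cinner (B *v u) x"
    by (simp add: S cinner_simps cinner_adj_right)
  also have "\<dots> = ?s * cinner y x + cinner (?A *v y) x"
    unfolding B by (simp add: cinner_simps)
  also have "\<dots> = - cinner y ((Q ** R ** Q) *v y)"
    unfolding A by (simp add: cinner_simps cinner_adj_right)
  finally have sum0: "cinner u (S *v u) + cinner y ((Q ** R ** Q) *v y) = 0" by simp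
  have S0: "cinner u (S *v u) \<in> \<real>\<^sub>\<ge>\<^sub>0" using psd(5) by (simp add: psd_iff vecs_def)
  note zero = nonneg_Reals_add_eq_0[OF S0 QRQ_form_nonneg[OF psd(1,3)] sum0]
  show "S *v u = 0" using psd_form_eq_0[OF psd(4,5) zero(1)] .
  show "(R ** Q) *v y = 0" using QRQ_form_eq_0[OF psd(1-3) zero(2)] .
qed

lemma A_mult_on_ker_RQ:
  fixes J R Q :: "complex^'n^'n"
  shows "(R ** Q) *v y = 0 \<Longrightarrow> ((J - R) ** Q) *v y = (J ** Q) *v y"
  by (simp add: matrix_vector_mult_diff_rdistrib flip: matrix_vector_mul_assoc)

lemma adj_matrix_diff_imaginary: "adj (A - mat (\<i> * of_real \<omega>)) = adj A + mat (\<i> * of_real \<omega>)"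
  by (simp add: adj_def mat_def vec_eq_iff)

text \<open>The range of \<open>D\<close> is orthogonal to the kernel of \<open>D\<^sup>H\<close>.\<close>

lemma adj_kernel_trivial:
  assumes "invertible D" "adj D *v x = 0"
  shows "x = 0"
proof (rule ccontr)
  assume "x \<noteq> 0"
  moreover have "D *v (matrix_inv D *v x) = x"
    using mult_eq_iff_matrix_inv[OF assms(1)] by blast
  then have "cinner x x = cinner (adj D *v x) (matrix_inv D *v x)"
    by (simp add: cinner_adj)
  then have "cinner x x = 0" by (simp add: assms(2) cinner_zero_left)
  ultimately show False using cinner_self_pos by fastforce
qed

text \<open>
  The right-hand side negates the condition of (iii), with \<open>y = - (A - i \<omega>)\<^sup>-\<^sup>1 B u\<close> as an explicit
  witness; in this form it can be compared with (iv) and (v).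
\<close>

lemma A_mat_kernel_imaginary_iff:
  assumes psd: "adj Q = Q" "adj R = R" "psd UNIV R" "adj S = S" "psd UNIV S"
    and \<omega>: "\<i> * of_real \<omega> \<notin> spectrum ((J - R) ** Q)"
  shows "(\<exists>z. z \<noteq> 0 \<and> A_mat J R Q B S *v z = (\<i> * of_real \<omega>) *s (E_mat *v z)) \<longleftrightarrow>
    (\<exists>u y. u \<noteq> 0 \<and> S *v u = 0 \<and> (R ** Q) *v y = 0 \<and>
      ((J - R) ** Q - mat (\<i> * of_real \<omega>)) *v y = - (B *v u))"
    (is "?L \<longleftrightarrow> ?R")
proof -
  let ?A = "(J - R) ** Q" and ?s = "\<i> * of_real \<omega> :: complex"
  have inv: "invertible (?A - mat ?s)" using \<omega> by (simp add: invertible_diff_mat_iff)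
  have D: "(?A - mat ?s) *v y = - (B *v u) \<longleftrightarrow> ?A *v y + B *v u = ?s *s y" for y u
    by (auto simp: matrix_vector_mult_diff_rdistrib mat_mult_vector algebra_simps eq_neg_iff_add_eq_0)
  show ?thesis
  proof
    assume ?L
    then obtain x y u where nz: "vjoin (vjoin x y) u \<noteq> 0"
      and k: "A_mat J R Q B S *v vjoin (vjoin x y) u = ?s *s (E_mat *v vjoin (vjoin x y) u)"
      by (metis vjoin_cases)
    note rows = k[unfolded A_mat_eigen_iff, THEN conjunct1]
      k[unfolded A_mat_eigen_iff, THEN conjunct2, THEN conjunct1]
      k[unfolded A_mat_eigen_iff, THEN conjunct2, THEN conjunct2]
    note zero = A_mat_kernel_imaginary[OF psd rows]
    have "(Q ** R ** Q) *v y = 0"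
      by (metis zero(2) matrix_mul_assoc matrix_vector_mul_assoc matrix_vector_mult_0_right)
    then have "adj (?A - mat ?s) *v x = 0"
      using rows(2) by (simp add: adj_matrix_diff_imaginary matrix_vector_mult_add_rdistrib mat_mult_vector)
    with inv have x: "x = 0" by (rule adj_kernel_trivial)
    have "u \<noteq> 0"
    proof
      assume u: "u = 0"
      then have "(?A - mat ?s) *v y = 0" using rows(1) D[of y u] by simp
      then have "y = 0" using inv by (simp add: invertible_iff_kernel)
      with x u nz show False by (simp add: zero_eq_vjoin)
    qed
    then show ?R using zero rows(1) D by blast
  next
    assume ?R
    then obtain u y where uy: "u \<noteq> 0" "S *v u = 0" "(R ** Q) *v y = 0" "?A *v y + B *v u = ?s *s y"
      using D by blast
    have "(Q ** R ** Q) *v y = 0"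
      by (metis uy(3) matrix_mul_assoc matrix_vector_mul_assoc matrix_vector_mult_0_right)
    then have "A_mat J R Q B S *v vjoin (vjoin 0 y) u = ?s *s (E_mat *v vjoin (vjoin 0 y) u)"
      unfolding A_mat_eigen_iff using uy by simp
    moreover have "vjoin (vjoin 0 y) u \<noteq> 0" using uy(1) by (simp add: zero_eq_vjoin vjoin_eq_iff)
    ultimately show ?L by blast
  qed
qed

text \<open>
  For an eigenvector \<open>v\<close> the form \<open>(Q v)\<^sup>H (J - R) Q v = i \<omega> v\<^sup>H Q v\<close> is imaginary, and its real part
  is \<open>- v\<^sup>H Q R Q v\<close> because \<open>J\<close> is skew-Hermitian; so \<open>R Q v = 0\<close>.
\<close>

lemma imaginary_spectrum_subset:
  assumes "adj Q = Q" "adj R = R" "psd UNIV R" "J = - adj J"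
    and "\<i> * of_real \<omega> \<in> spectrum ((J - R) ** Q)"
  shows "\<i> * of_real \<omega> \<in> spectrum (J ** Q)"
proof -
  let ?s = "\<i> * of_real \<omega> :: complex"
  obtain v where v: "v \<noteq> 0" "((J - R) ** Q) *v v = ?s *s v"
    using assms(5) by (auto simp: spectrum_def)
  define w where "w = Q *v v"
  have form: "cinner w (J *v w) - cinner w (R *v w) = ?s * cinner w v"
    by (metis v(2) w_def cinner_diff_right cinner_scale_right matrix_vector_mul_assoc
        matrix_vector_mult_diff_rdistrib)
  have "cnj (cinner w v) = cinner w v"
    by (metis assms(1) cinner_adj cnj_cinner w_def)
  then have 1: "Re (?s * cinner w v) = 0" by (simp add: complex_eq_iff)
  have "cnj (cinner w (J *v w)) = - cinner w (J *v w)"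
  proof -
    have "cnj (cinner w (J *v w)) = cinner w (adj J *v w)"
      by (simp add: cnj_cinner cinner_adj_right)
    also have "adj J *v w = - (J *v w)" by (subst (2) assms(4)) (simp add: minus_matrix_vector_mult)
    finally show ?thesis by (simp add: cinner_simps)
  qed
  then have 2: "Re (cinner w (J *v w)) = 0" by (simp add: complex_eq_iff)
  have "cinner w (R *v w) \<in> \<real>\<^sub>\<ge>\<^sub>0" using assms(3) by (simp add: psd_iff vecs_def)
  moreover have "Re (cinner w (R *v w)) = 0"
    using arg_cong[OF form, of Re] 1 2 by simp
  ultimately have "cinner w (R *v w) = 0"
    by (auto simp: complex_nonneg_Reals_iff complex_eq_iff)
  then have "R *v w = 0" using psd_form_eq_0 assms(2,3) by blast
  then have "(R ** Q) *v v = 0" by (simp add: w_def matrix_vector_mul_assoc)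
  then have "(J ** Q) *v v = ?s *s v" using v(2) A_mult_on_ker_RQ by metis
  with v(1) show ?thesis by (auto simp: spectrum_def)
qed

section \<open>The kernel conditions\<close>

lemma kernel_condition_inv_iff:
  fixes S :: "complex^'m^'m" and T D :: "complex^'n^'n"
  assumes "invertible D"
  shows "ker S \<inter> ker (T ** matrix_inv D ** B) = {0} \<longleftrightarrow>
    \<not> (\<exists>u y. u \<noteq> 0 \<and> S *v u = 0 \<and> T *v y = 0 \<and> D *v y = - (B *v u))"
proof -
  have "T *v (matrix_inv D *v (B *v u)) = 0 \<longleftrightarrow> (\<exists>y. T *v y = 0 \<and> D *v y = - (B *v u))" for u
    using mult_eq_iff_matrix_inv[OF assms, of _ "- (B *v u)"] by (simp add: vec.neg)
  moreover have "ker S \<inter> ker (T ** matrix_inv D ** B) = {0} \<longleftrightarrow>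
      \<not> (\<exists>u. u \<noteq> 0 \<and> S *v u = 0 \<and> T *v (matrix_inv D *v (B *v u)) = 0)"
    by (auto simp: ker_def simp flip: matrix_vector_mul_assoc)
  ultimately show ?thesis by simp
qed

lemma kernel_condition_preimage_iff:
  fixes S :: "complex^'m^'m" and T D :: "complex^'n^'n"
  shows "ker S \<inter> (\<lambda>u. B *v u) -` ((\<lambda>x. D *v x) ` ker T) = {0} \<longleftrightarrow>
    \<not> (\<exists>u y. u \<noteq> 0 \<and> S *v u = 0 \<and> T *v y = 0 \<and> D *v y = - (B *v u))"
proof -
  have "(\<exists>y. T *v y = 0 \<and> D *v y = - (B *v u)) \<longleftrightarrow> B *v u \<in> (\<lambda>x. D *v x) ` ker T" for u
  proof -
    have "(\<exists>y. T *v y = 0 \<and> D *v y = - (B *v u)) \<longleftrightarrow>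
        (\<exists>x. T *v (- x) = 0 \<and> D *v (- x) = - (B *v u))"
      by (rule iffI; elim exE) (rule exI[of _ "- _"], simp, blast)
    then show ?thesis by (simp add: ker_def vec.neg image_iff Bex_def eq_commute[of "B *v u"])
  qed
  moreover have "0 \<in> (\<lambda>x. D *v x) ` ker T"
    by (rule image_eqI[of _ _ 0]) (simp_all add: ker_def)
  then have "ker S \<inter> (\<lambda>u. B *v u) -` ((\<lambda>x. D *v x) ` ker T) = {0} \<longleftrightarrow>
      \<not> (\<exists>u. u \<noteq> 0 \<and> S *v u = 0 \<and> B *v u \<in> (\<lambda>x. D *v x) ` ker T)"
    by (auto simp: ker_def[of S])
  ultimately show ?thesis by simp
qed

theorem proposition3p1:
  fixes K :: "complex set"
    and J R Q :: "complex^'n^'n" and B :: "complex^'m^'n" and S :: "complex^'m^'m"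
  assumes "K = \<real> \<or> K = UNIV"
    and "(J, R, Q, B) \<in> Sigma_ph K"
    and "S \<in> mats K" and "adj S = S" and "psd K S"
  shows
    "(regular_pencil E_mat (A_mat J R Q B S) \<longleftrightarrow>
       (\<exists>\<mu> \<in> K - (spectrum (- adj ((J - R) ** Q)) \<union> spectrum ((J - R) ** Q)).
          S_mu J R Q B S \<mu> \<in> mats K \<and> invertible (S_mu J R Q B S \<mu>))) \<and>
     (regular_pencil E_mat (A_mat J R Q B S) \<longleftrightarrow>
       (\<exists>\<omega>::real. \<i> * of_real \<omega> \<notin> spectrum ((J - R) ** Q) \<and>
          ker S \<inter> ker (R ** Q ** matrix_inv ((J - R) ** Q - mat (\<i> * of_real \<omega>)) ** B) = {0})) \<and>
     (regular_pencil E_mat (A_mat J R Q B S) \<longleftrightarrow>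
       (\<exists>\<omega>::real. \<i> * of_real \<omega> \<notin> spectrum (J ** Q) \<and>
          ker S \<inter> ker (R ** Q ** matrix_inv (J ** Q - mat (\<i> * of_real \<omega>)) ** B) = {0})) \<and>
     (regular_pencil E_mat (A_mat J R Q B S) \<longleftrightarrow>
       (\<exists>\<omega>::real. \<i> * of_real \<omega> \<notin> spectrum (J ** Q) \<and>
          ker S \<inter> (\<lambda>u. B *v u) -`
            ((\<lambda>x. (J ** Q - mat (\<i> * of_real \<omega>)) *v x) ` ker (R ** Q)) = {0}))"
proof -
  let ?A = "(J - R) ** Q" and ?P = "A_mat J R Q B S"
  let ?bad = "{s. \<exists>z. z \<noteq> 0 \<and> ?P *v z = s *s (E_mat *v z)}"
  let ?F = "spectrum (- adj ?A) \<union> spectrum ?A"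
  have Sigma: "J \<in> mats K" "R \<in> mats K" "Q \<in> mats K" "B \<in> mats K" "J = - adj J" "adj R = R" "adj Q = Q"
    "psd K R"
    using assms(2) by (auto simp: Sigma_ph_def)
  have psd: "adj Q = Q" "adj R = R" "psd UNIV R" "adj S = S" "psd UNIV S"
    using psd_UNIV_if_psd[OF assms(1)] Sigma assms(3-5) by auto
  have regularI: "regular_pencil E_mat ?P" if "s \<notin> ?bad" for s
    using that by (intro regular_pencilI[of _ s]) blast

  have ii: "regular_pencil E_mat ?P \<longleftrightarrow>
      (\<exists>\<mu> \<in> K - ?F. S_mu J R Q B S \<mu> \<in> mats K \<and> invertible (S_mu J R Q B S \<mu>))" (is "_ \<longleftrightarrow> ?ii")
  proof
    assume "regular_pencil E_mat ?P"
    then have "finite (?bad \<union> ?F)"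
      by (simp add: finite_pencil_eigenvalues finite_spectrum)
    moreover have "infinite K"
    proof -
      have "infinite (range (of_nat :: nat \<Rightarrow> complex))"
        by (simp add: finite_image_iff inj_on_def)
      moreover have "range of_nat \<subseteq> K" using assms(1) by auto
      ultimately show ?thesis using finite_subset by blast
    qed
    ultimately have "\<not> K \<subseteq> ?bad \<union> ?F" by (meson finite_subset)
    then obtain \<mu> where \<mu>: "\<mu> \<in> K" "\<mu> \<notin> ?bad" "\<mu> \<notin> ?F" by blast
    then have "invertible (S_mu J R Q B S \<mu>)" using A_mat_kernel_iff_S_mu by blast
    with \<mu> S_mu_in_mats[OF assms(1) Sigma(1-4) assms(3)] show ?ii by blast
  next
    assume ?ii
    then obtain \<mu> where "\<mu> \<notin> ?F" "invertible (S_mu J R Q B S \<mu>)" by blast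
    then have "\<mu> \<notin> ?bad" using A_mat_kernel_iff_S_mu[of \<mu> J R Q B S] by blast
    then show "regular_pencil E_mat ?P" by (rule regularI)
  qed

  define cond where "cond D \<longleftrightarrow>
    \<not> (\<exists>u y. u \<noteq> 0 \<and> S *v u = 0 \<and> (R ** Q) *v y = 0 \<and> D *v y = - (B *v u))" for D
  have cond_A: "cond (?A - mat (\<i> * of_real \<omega>)) \<longleftrightarrow> \<i> * of_real \<omega> \<notin> ?bad"
    if "\<i> * of_real \<omega> \<notin> spectrum ?A" for \<omega> :: real
    using A_mat_kernel_imaginary_iff[OF psd that] by (simp add: cond_def)
  have cond_JQ: "cond (J ** Q - mat s) \<longleftrightarrow> cond (?A - mat s)" for s
  proof -
    have "(J ** Q - mat s) *v y = (?A - mat s) *v y" if "(R ** Q) *v y = 0" for y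
      using A_mult_on_ker_RQ[OF that, of J] by (simp add: matrix_vector_mult_diff_rdistrib)
    then show ?thesis unfolding cond_def by metis
  qed
  have JQ_A: "\<i> * of_real \<omega> \<notin> spectrum ?A" if "\<i> * of_real \<omega> \<notin> spectrum (J ** Q)" for \<omega> :: real
    using imaginary_spectrum_subset[OF psd(1-3) Sigma(5)] that by blast
  have good: "\<exists>\<omega>::real. \<i> * of_real \<omega> \<notin> spectrum (J ** Q) \<and> \<i> * of_real \<omega> \<notin> ?bad"
    if "regular_pencil E_mat ?P"
    using ex_imaginary_notin_finite[of "spectrum (J ** Q) \<union> ?bad"] that
    by (simp add: finite_pencil_eigenvalues finite_spectrum)
  have iii: "regular_pencil E_mat ?P \<longleftrightarrow>
      (\<exists>\<omega>::real. \<i> * of_real \<omega> \<notin> spectrum ?A \<and> cond (?A - mat (\<i> * of_real \<omega>)))"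
    using good JQ_A cond_A regularI by meson
  have iv: "regular_pencil E_mat ?P \<longleftrightarrow>
      (\<exists>\<omega>::real. \<i> * of_real \<omega> \<notin> spectrum (J ** Q) \<and> cond (J ** Q - mat (\<i> * of_real \<omega>)))"
    unfolding cond_JQ using good JQ_A cond_A regularI by meson
  have ker_inv: "ker S \<inter> ker (R ** Q ** matrix_inv (M - mat s) ** B) = {0} \<longleftrightarrow> cond (M - mat s)"
    if "s \<notin> spectrum M" for M s
    using that unfolding cond_def by (intro kernel_condition_inv_iff) (simp add: invertible_diff_mat_iff)
  have ker_preimage: "ker S \<inter> (\<lambda>u. B *v u) -` ((\<lambda>x. D *v x) ` ker (R ** Q)) = {0} \<longleftrightarrow> cond D" for D
    unfolding cond_def by (rule kernel_condition_preimage_iff)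
  show ?thesis
    using ii iii iv by (simp add: ker_inv ker_preimage cong: conj_cong)
qed

end
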